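(* Let $n\ge 1$ and let $J_n$ be the $n\times n$ nilpotent Jordan block, i.e. the matrix with entries $1$ at positions $(i,i+1)$ for $1\le i\le n-1$ and $0$ elsewhere. Then the Harnack part of $J_n$ in $C_1(\mathbb{C}^n)$ is precisely the set of all matrices of the form $$M=\begin{pmatrix}0&1&0&\cdots&0\\0&0&\ddots&\ddots&\vdots\\ \vdots&\vdots&\ddots&\ddots&0\\0&0&\cdots&\ddots&1\\ z&0&\cdots&\cdots&0\end{pmatrix}$$ (that is, $J_n$ with its lower left entry, at position $(n,1)$, replaced by $z$), where $z$ ranges over the open unit disc.
   Context: $C_1(\mathbb{C}^n)$ is the set of contractions on the Hilbert space $\mathbb{C}^n$ (matrices with operator norm at most $1$). For $T\in C_1(\mathbb{C}^n)$ and $z$ in the open unit disc $\mathbb{D}$, put $K_z(T)=(I-\overline{z}T)^{-1}+(I-zT^* )^{-1}-I$. For $T_0,T_1\in C_1(\mathbb{C}^n)$, $T_1$ is Harnack dominated by $T_0$ if there is a constant $c\ge 1$ with $K_z(T_1)\le c^2K_z(T_0)$ for all $z\in\mathbb{D}$; they are Harnack equivalent if each is Harnack dominated by the other. The Harnack part of $T$ is its equivalence class under Harnack equivalence. *)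

theory Defs
  imports
    "HOL-Analysis.Analysis"
    "Jordan_Normal_Form.Schur_Decomposition"
    "Jordan_Normal_Form.Jordan_Normal_Form"
    "Jordan_Normal_Form.Gauss_Jordan_Elimination"
begin

text \<open>The Hilbert space \<open>\<complex>\<^sup>n\<close> is \<open>carrier_vec n\<close> with the inner product \<open>\<bullet>c\<close>, which is linear in the
  first argument. Indices are 0-based.\<close>

definition cvec_norm :: "complex vec \<Rightarrow> real" where
  "cvec_norm v = sqrt (Re (v \<bullet>c v))"

definition op_norm :: "complex mat \<Rightarrow> real" where
  "op_norm A = Sup {cvec_norm (A *\<^sub>v v) | v. v \<in> carrier_vec (dim_col A) \<and> cvec_norm v \<le> 1}"

definition contractions :: "nat \<Rightarrow> complex mat set" where
  "contractions n = {T \<in> carrier_mat n n. op_norm T \<le> 1}"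

text \<open>The order on \<open>complex\<close> is the one of \<open>Complex_Order\<close>: \<open>0 \<le> w\<close> says that \<open>w\<close> is real and
  nonnegative. Over the complex numbers this makes \<open>B - A\<close> automatically Hermitian.\<close>

definition loewner_le :: "nat \<Rightarrow> complex mat \<Rightarrow> complex mat \<Rightarrow> bool" where
  "loewner_le n A B \<longleftrightarrow> A \<in> carrier_mat n n \<and> B \<in> carrier_mat n n \<and>
     (\<forall>v \<in> carrier_vec n. 0 \<le> ((B - A) *\<^sub>v v) \<bullet>c v)"

text \<open>\<open>mat_inverse\<close> is option-valued. For a contraction \<open>T\<close> and \<open>z\<close> in the open unit disc both
  inverses exist: see \<open>contraction_resolvent\<close>, and note that \<open>1 - z T\<^sup>*\<close> is the adjoint of
  \<open>1 - cnj z T\<close>.\<close>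

definition harnack_kernel :: "nat \<Rightarrow> complex \<Rightarrow> complex mat \<Rightarrow> complex mat" where
  "harnack_kernel n z T =
     the (mat_inverse (1\<^sub>m n - cnj z \<cdot>\<^sub>m T))
     + the (mat_inverse (1\<^sub>m n - z \<cdot>\<^sub>m mat_adjoint T)) - 1\<^sub>m n"

definition harnack_dominated :: "nat \<Rightarrow> complex mat \<Rightarrow> complex mat \<Rightarrow> bool" where
  "harnack_dominated n T1 T0 \<longleftrightarrow>
     (\<exists>c::real. c \<ge> 1 \<and> (\<forall>z. cmod z < 1 \<longrightarrow>
        loewner_le n (harnack_kernel n z T1)
          (complex_of_real (c\<^sup>2) \<cdot>\<^sub>m harnack_kernel n z T0)))"

definition harnack_equivalent :: "nat \<Rightarrow> complex mat \<Rightarrow> complex mat \<Rightarrow> bool" where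
  "harnack_equivalent n S T \<longleftrightarrow> harnack_dominated n S T \<and> harnack_dominated n T S"

definition harnack_part :: "nat \<Rightarrow> complex mat \<Rightarrow> complex mat set" where
  "harnack_part n T = {S \<in> contractions n. harnack_equivalent n S T}"

definition corner_jordan_block :: "nat \<Rightarrow> complex \<Rightarrow> complex mat" where
  "corner_jordan_block n z =
     mat n n (\<lambda>(i, j). if i = n - 1 \<and> j = 0 then z else jordan_block n 0 $$ (i, j))"

lemma cvec_norm_L2: "cvec_norm v = L2_set (\<lambda>i. cmod (v $ i)) {..<dim_vec v}"
proof -
  have "Re (v $ i * cnj (v $ i)) = (cmod (v $ i))\<^sup>2" for i
    by (metis Re_complex_of_real complex_norm_square)
  then show ?thesis
    unfolding cvec_norm_def L2_set_def scalar_prod_def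
    by (simp add: atLeast0LessThan conjugate_complex_def del: complex_mult_cnj)
qed

lemma cvec_norm_nonneg [simp]: "0 \<le> cvec_norm v"
  by (simp add: cvec_norm_L2 L2_set_nonneg)

lemma cvec_norm_smult: "cvec_norm (c \<cdot>\<^sub>v v) = cmod c * cvec_norm v"
  by (simp add: cvec_norm_L2 norm_mult L2_set_right_distrib cong: L2_set_cong_simp)

lemma cvec_norm_eq_0: "v \<in> carrier_vec n \<Longrightarrow> cvec_norm v = 0 \<longleftrightarrow> v = 0\<^sub>v n"
  by (auto simp: cvec_norm_L2 L2_set_eq_0_iff)

lemma bdd_above_op_norm:
  assumes A: "A \<in> carrier_mat m n"
  shows "bdd_above {cvec_norm (A *\<^sub>v v) | v. v \<in> carrier_vec (dim_col A) \<and> cvec_norm v \<le> 1}"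
proof (rule bdd_aboveI)
  fix x assume "x \<in> {cvec_norm (A *\<^sub>v v) | v. v \<in> carrier_vec (dim_col A) \<and> cvec_norm v \<le> 1}"
  then obtain v where v: "v \<in> carrier_vec n" and n1: "cvec_norm v \<le> 1"
    and x: "x = cvec_norm (A *\<^sub>v v)" using A by auto
  have comp: "cmod (v $ j) \<le> 1" if "j < n" for j
    using member_le_L2_set[of "{..<n}" j "\<lambda>i. cmod (v $ i)"] that v n1
    by (simp add: cvec_norm_L2)
  have "cmod ((A *\<^sub>v v) $ i) \<le> (\<Sum>j<n. cmod (A $$ (i, j)))" if i: "i < m" for i
  proof -
    have "(A *\<^sub>v v) $ i = (\<Sum>j<n. A $$ (i, j) * v $ j)"
      using A v i by (simp add: scalar_prod_def atLeast0LessThan)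
    also have "cmod \<dots> \<le> (\<Sum>j<n. cmod (A $$ (i, j)))"
    proof (rule sum_norm_le)
      fix j assume "j \<in> {..<n}"
      then show "cmod (A $$ (i, j) * v $ j) \<le> cmod (A $$ (i, j))"
        using comp[of j] by (simp add: norm_mult mult_left_le)
    qed
    finally show ?thesis .
  qed
  then have "(\<Sum>i<m. cmod ((A *\<^sub>v v) $ i)) \<le> (\<Sum>i<m. \<Sum>j<n. cmod (A $$ (i, j)))"
    by (intro sum_mono) auto
  moreover have "x \<le> (\<Sum>i<m. cmod ((A *\<^sub>v v) $ i))"
    using A by (simp add: x cvec_norm_L2 del: index_mult_mat_vec) (rule L2_set_le_sum, simp)
  ultimately show "x \<le> (\<Sum>i<m. \<Sum>j<n. cmod (A $$ (i, j)))" by linarith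
qed

lemma op_norm_le_1_iff:
  assumes A: "A \<in> carrier_mat m n"
  shows "op_norm A \<le> 1 \<longleftrightarrow> (\<forall>v \<in> carrier_vec n. cvec_norm (A *\<^sub>v v) \<le> cvec_norm v)"
proof
  assume le: "op_norm A \<le> 1"
  show "\<forall>v \<in> carrier_vec n. cvec_norm (A *\<^sub>v v) \<le> cvec_norm v"
  proof
    fix v :: "complex vec" assume v: "v \<in> carrier_vec n"
    show "cvec_norm (A *\<^sub>v v) \<le> cvec_norm v"
    proof (cases "cvec_norm v = 0")
      case True
      then have "v = 0 \<cdot>\<^sub>v v" using cvec_norm_eq_0[OF v] v by auto
      then have "cvec_norm (A *\<^sub>v v) = cvec_norm (0 \<cdot>\<^sub>v (A *\<^sub>v v))"
        using mult_mat_vec[OF A v, of 0] by simp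
      then show ?thesis by (simp add: cvec_norm_smult)
    next
      case False
      then have pos: "cvec_norm v > 0" by (simp add: order_less_le)
      define c where "c = complex_of_real (1 / cvec_norm v)"
      have c: "cmod c = 1 / cvec_norm v" using pos by (simp add: c_def norm_divide)
      have "cvec_norm (A *\<^sub>v (c \<cdot>\<^sub>v v)) \<le> op_norm A"
        unfolding op_norm_def
        by (rule cSup_upper[OF _ bdd_above_op_norm[OF A]])
           (use A v pos in \<open>auto simp: cvec_norm_smult c intro!: exI[of _ "c \<cdot>\<^sub>v v"]\<close>)
      then have "cmod c * cvec_norm (A *\<^sub>v v) \<le> 1"
        using le by (simp add: mult_mat_vec[OF A v] cvec_norm_smult)
      then show ?thesis using pos by (simp add: c field_simps)
    qed
  qed
next
  assume *: "\<forall>v \<in> carrier_vec n. cvec_norm (A *\<^sub>v v) \<le> cvec_norm v"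
  show "op_norm A \<le> 1"
    unfolding op_norm_def
  proof (rule cSup_least)
    have "cvec_norm (0\<^sub>v n) = 0" by (simp add: cvec_norm_eq_0[of _ n])
    then show "{cvec_norm (A *\<^sub>v v) | v. v \<in> carrier_vec (dim_col A) \<and> cvec_norm v \<le> 1} \<noteq> {}"
      using A by (auto intro!: exI[of _ "0\<^sub>v n"])
  next
    fix x assume "x \<in> {cvec_norm (A *\<^sub>v v) | v. v \<in> carrier_vec (dim_col A) \<and> cvec_norm v \<le> 1}"
    then show "x \<le> 1" using * A by force
  qed
qed

lemma contraction_resolvent:
  assumes T: "T \<in> contractions n" and z: "cmod z < 1"
  obtains B where "mat_inverse (1\<^sub>m n - cnj z \<cdot>\<^sub>m T) = Some B" "B \<in> carrier_mat n n"
    "(1\<^sub>m n - cnj z \<cdot>\<^sub>m T) * B = 1\<^sub>m n" "B * (1\<^sub>m n - cnj z \<cdot>\<^sub>m T) = 1\<^sub>m n"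
proof -
  let ?A = "1\<^sub>m n - cnj z \<cdot>\<^sub>m T"
  have Tc: "T \<in> carrier_mat n n" and op: "op_norm T \<le> 1"
    using T by (auto simp: contractions_def)
  have A: "?A \<in> carrier_mat n n" using Tc by auto
  have "det ?A \<noteq> 0"
  proof
    assume "det ?A = 0"
    then obtain v where v: "v \<in> carrier_vec n" "v \<noteq> 0\<^sub>v n" "?A *\<^sub>v v = 0\<^sub>v n"
      using det_0_iff_vec_prod_zero[OF A] by auto
    have Tv: "T *\<^sub>v v \<in> carrier_vec n" using Tc v by auto
    have mv: "?A *\<^sub>v v = v - cnj z \<cdot>\<^sub>v (T *\<^sub>v v)"
      using Tc v(1) by (auto simp: minus_mult_distrib_mat_vec[of _ n n])
    have "v = cnj z \<cdot>\<^sub>v (T *\<^sub>v v)"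
    proof (rule eq_vecI)
      fix i assume i: "i < dim_vec (cnj z \<cdot>\<^sub>v (T *\<^sub>v v))"
      then have "(v - cnj z \<cdot>\<^sub>v (T *\<^sub>v v)) $ i = 0"
        using v(3) mv Tv by (metis carrier_vecD index_smult_vec(2) index_zero_vec(1))
      then show "v $ i = (cnj z \<cdot>\<^sub>v (T *\<^sub>v v)) $ i" using i by simp
    qed (use v Tv Tc in auto)
    then have "cvec_norm v = cmod z * cvec_norm (T *\<^sub>v v)"
      by (metis cvec_norm_smult complex_mod_cnj)
    also have "\<dots> \<le> cmod z * cvec_norm v"
      using op v(1) op_norm_le_1_iff[OF Tc] by (simp add: mult_left_mono)
    finally have le: "cvec_norm v \<le> cmod z * cvec_norm v" .
    have "cvec_norm v > 0"
      using cvec_norm_eq_0[OF v(1)] v(2) by (simp add: order_less_le)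
    then have "cmod z * cvec_norm v < 1 * cvec_norm v"
      using z by (intro mult_strict_right_mono)
    with le show False by simp
  qed
  then have "?A \<in> Units (ring_mat TYPE(complex) n ())"
    using det_non_zero_imp_unit[OF A] by simp
  then obtain B where B: "mat_inverse ?A = Some B"
    using mat_inverse(1)[OF A, where b = "()"] by (cases "mat_inverse ?A") auto
  show ?thesis
    using that[OF B] mat_inverse(2)[OF A B] by auto
qed

end

theory Submission
  imports Defs
begin

text \<open>
  The kernel factors as
  \<open>K\<^sub>z(T) = (I - z T\<^sup>*)\<^sup>-\<^sup>1 (I - |z|\<^sup>2 T\<^sup>* T) (I - cnj z T)\<^sup>-\<^sup>1\<close>, so on \<open>v = (I - cnj z T) u\<close> its
  quadratic form is \<open>\<parallel>u\<parallel>\<^sup>2 - |z|\<^sup>2 \<parallel>T u\<parallel>\<^sup>2\<close>. For the matrices with corner entry of modulus less than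
  \<open>1\<close> these forms are explicit sums of squares, and they are comparable.

  Conversely let \<open>T\<close> be equivalent to \<open>J\<close>. Since \<open>(I - \<omega> J)\<^sup>-\<^sup>1\<close> is a polynomial in \<open>\<omega>\<close>, one can let
  \<open>|z|\<close> tend to \<open>1\<close>: for every \<open>\<omega>\<close> on the unit circle \<open>\<parallel>u\<parallel>\<^sup>2 - \<parallel>T u\<parallel>\<^sup>2\<close> is comparable with
  \<open>|L\<^sub>\<omega>(u)|\<^sup>2\<close>, where \<open>L\<^sub>\<omega>(u)\<close> is the first coordinate of \<open>(I - \<omega> J)\<^sup>-\<^sup>1 (I - \<omega> T) u\<close>. Hence the kernel of
  \<open>L\<^sub>\<omega>\<close> does not depend on \<open>\<omega>\<close>. As \<open>L\<^sub>\<omega>(u)\<close> is a polynomial in \<open>\<omega>\<close> with constant term \<open>u\<^sub>0\<close>, this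
  kernel is spanned by the unit vectors other than \<open>e\<^sub>0\<close>, and comparing coefficients of \<open>L\<^sub>\<omega>(e\<^sub>j) = 0\<close>
  gives \<open>T e\<^sub>j = e\<^bsub>j-1\<^esub>\<close> for \<open>j > 0\<close>. Contractivity then leaves only the corner entry free in the
  first column, and \<open>\<parallel>T e\<^sub>0\<parallel> < 1\<close>.
\<close>

unbundle no vec_syntax

section \<open>Inner product, norm and adjoint\<close>

lemma cscalar_prod_self: "v \<bullet>c v = complex_of_real ((cvec_norm v)\<^sup>2)"
proof -
  have "v \<bullet>c v = (\<Sum>i<dim_vec v. complex_of_real ((cmod (v $ i))\<^sup>2))"
    by (simp add: scalar_prod_def atLeast0LessThan conjugate_complex_def
        complex_norm_square[symmetric] del: complex_mult_cnj of_real_power)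
  then show ?thesis
    by (simp add: cvec_norm_L2 L2_set_def sum_nonneg)
qed

lemma cvec_norm_sq: "v \<in> carrier_vec n \<Longrightarrow> (cvec_norm v)\<^sup>2 = (\<Sum>i<n. (cmod (v $ i))\<^sup>2)"
  by (simp add: cvec_norm_L2 L2_set_def sum_nonneg)

lemma mat_adjoint_dim [simp]:
  "dim_row (mat_adjoint A) = dim_col A" "dim_col (mat_adjoint A) = dim_row A"
  by (simp_all add: mat_adjoint_def)

lemma mat_adjoint_carrier [simp]: "A \<in> carrier_mat n n \<Longrightarrow> mat_adjoint A \<in> carrier_mat n n"
  by (intro carrier_matI) auto

lemma mat_adjoint_index:
  "A \<in> carrier_mat n n \<Longrightarrow> i < n \<Longrightarrow> j < n \<Longrightarrow> mat_adjoint A $$ (i, j) = conjugate (A $$ (j, i))"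
  by (simp add: mat_adjoint_def mat_of_rows_index)

lemma mat_adjoint_mult:
  fixes A B :: "complex mat"
  assumes "A \<in> carrier_mat n n" "B \<in> carrier_mat n n"
  shows "mat_adjoint (A * B) = mat_adjoint B * mat_adjoint A"
proof (rule eq_matI)
  fix i j assume ij: "i < dim_row (mat_adjoint B * mat_adjoint A)"
    "j < dim_col (mat_adjoint B * mat_adjoint A)"
  have n: "i < n" "j < n" using ij assms by (auto simp: mat_adjoint_def)
  have "mat_adjoint A \<in> carrier_mat n n" "mat_adjoint B \<in> carrier_mat n n" "A * B \<in> carrier_mat n n"
    using assms by auto
  then show "mat_adjoint (A * B) $$ (i, j) = (mat_adjoint B * mat_adjoint A) $$ (i, j)"
    using assms n
    by (auto simp: mat_adjoint_index[of _ n] scalar_prod_def mult.commute intro!: sum.cong)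
qed (use assms in \<open>auto simp: mat_adjoint_def\<close>)

lemma mat_adjoint_cscalar_prod:
  fixes A :: "complex mat"
  assumes A: "A \<in> carrier_mat n n" and x: "x \<in> carrier_vec n" and y: "y \<in> carrier_vec n"
  shows "(mat_adjoint A *\<^sub>v x) \<bullet>c y = x \<bullet>c (A *\<^sub>v y)"
proof -
  have mA: "mat_adjoint A \<in> carrier_mat n n" using A by simp
  have "(mat_adjoint A *\<^sub>v x) \<bullet>c y = (\<Sum>i<n. \<Sum>j<n. cnj (A $$ (j, i)) * x $ j * cnj (y $ i))"
    using A mA x y
    by (simp add: scalar_prod_def atLeast0LessThan mat_adjoint_index[of _ n]
        conjugate_complex_def sum_distrib_right)
  also have "\<dots> = (\<Sum>j<n. \<Sum>i<n. cnj (A $$ (j, i)) * x $ j * cnj (y $ i))"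
    by (rule sum.swap)
  also have "\<dots> = x \<bullet>c (A *\<^sub>v y)"
    using A x y
    by (simp add: scalar_prod_def atLeast0LessThan conjugate_complex_def sum_distrib_left mult_ac)
  finally show ?thesis .
qed

lemma minus_smult_mult_vec:
  fixes T :: "complex mat"
  assumes "T \<in> carrier_mat n n" "u \<in> carrier_vec n"
  shows "(1\<^sub>m n - c \<cdot>\<^sub>m T) *\<^sub>v u = u - c \<cdot>\<^sub>v (T *\<^sub>v u)"
  using assms by (auto simp: minus_mult_distrib_mat_vec[of _ n n])

section \<open>The quadratic form of the Harnack kernel\<close>

text \<open>For \<open>cmod z < 1\<close> and a contraction \<open>T\<close> this is the form of
  \<open>harnack_kernel n z T\<close> at \<open>v\<close>, written in the variable \<open>u\<close>
  with \<open>v = (I - cnj z T) u\<close>, so that no inverse occurs in it.\<close>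

definition energy :: "complex \<Rightarrow> complex mat \<Rightarrow> complex vec \<Rightarrow> real" where
  "energy z T u = (cvec_norm u)\<^sup>2 - (cmod z)\<^sup>2 * (cvec_norm (T *\<^sub>v u))\<^sup>2"

text \<open>Expand \<open>(u - v) \<bullet>c (u - v)\<close>. The left side is what the three
  summands of the kernel contribute at \<open>v\<close> when \<open>u\<close> is the resolvent of
  \<open>T\<close> applied to \<open>v\<close>.\<close>

lemma polarization:
  fixes u v :: "complex vec"
  assumes "u \<in> carrier_vec n" "v \<in> carrier_vec n"
  shows "u \<bullet>c v + v \<bullet>c u - v \<bullet>c v = u \<bullet>c u - (u - v) \<bullet>c (u - v)"
proof -
  have "(\<Sum>i<n. u $ i * cnj (v $ i)) + (\<Sum>i<n. v $ i * cnj (u $ i)) - (\<Sum>i<n. v $ i * cnj (v $ i))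
      = (\<Sum>i<n. u $ i * cnj (u $ i)) - (\<Sum>i<n. (u $ i - v $ i) * cnj (u $ i - v $ i))"
    unfolding sum.distrib[symmetric] sum_subtractf[symmetric]
    by (rule sum.cong) (simp_all add: algebra_simps del: complex_mult_cnj)
  then show ?thesis
    using assms
    by (simp add: scalar_prod_def conjugate_complex_def atLeast0LessThan del: complex_mult_cnj)
qed

lemma harnack_kernel_energy:
  assumes T: "T \<in> contractions n" and z: "cmod z < 1"
  shows "harnack_kernel n z T \<in> carrier_mat n n"
    and "u \<in> carrier_vec n \<Longrightarrow> v = u - cnj z \<cdot>\<^sub>v (T *\<^sub>v u) \<Longrightarrow>
      (harnack_kernel n z T *\<^sub>v v) \<bullet>c v = complex_of_real (energy z T u)"
proof -
  let ?A = "1\<^sub>m n - cnj z \<cdot>\<^sub>m T" and ?A' = "1\<^sub>m n - z \<cdot>\<^sub>m mat_adjoint T"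
  have Tc: "T \<in> carrier_mat n n" using T by (simp add: contractions_def)
  have A: "?A \<in> carrier_mat n n" and A': "?A' \<in> carrier_mat n n"
    using mat_adjoint_carrier[OF Tc] Tc by (blast intro: minus_carrier_mat smult_carrier_mat)+
  have adj: "mat_adjoint ?A = ?A'"
  proof (rule eq_matI)
    fix i j assume "i < dim_row ?A'" "j < dim_col ?A'"
    then have "i < n" "j < n" using A' by auto
    then show "mat_adjoint ?A $$ (i, j) = ?A' $$ (i, j)"
      using Tc A mat_adjoint_carrier[OF Tc]
      by (auto simp: mat_adjoint_index[of _ n] conjugate_complex_def)
  qed (use A A' in \<open>auto simp: mat_adjoint_def\<close>)
  have adj1: "mat_adjoint (1\<^sub>m n) = (1\<^sub>m n :: complex mat)"
    by (rule eq_matI) (auto simp: mat_adjoint_index[of _ n])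
  obtain B where inv: "mat_inverse ?A = Some B" and B: "B \<in> carrier_mat n n"
    and AB: "?A * B = 1\<^sub>m n" and BA: "B * ?A = 1\<^sub>m n"
    using contraction_resolvent[OF T z] by metis
  \<comment> \<open>Taking adjoints of \<open>B * ?A = 1\<close> and \<open>?A * B = 1\<close>
    exhibits \<open>?A'\<close> as a unit, so the option-valued \<open>mat_inverse\<close> returns a
    matrix.\<close>
  have "?A' * mat_adjoint B = 1\<^sub>m n" "mat_adjoint B * ?A' = 1\<^sub>m n"
    using mat_adjoint_mult[OF B A] mat_adjoint_mult[OF A B] by (simp_all add: adj adj1 AB BA)
  then have "?A' \<in> Units (ring_mat TYPE(complex) n ())"
    using A' B by (auto simp: Units_def ring_mat_def intro!: bexI[of _ "mat_adjoint B"])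
  then obtain B' where inv': "mat_inverse ?A' = Some B'"
    using mat_inverse(1)[OF A', where b = "()"] by (cases "mat_inverse ?A'") auto
  have B': "B' \<in> carrier_mat n n" and AB': "?A' * B' = 1\<^sub>m n"
    using mat_inverse(2)[OF A' inv'] by auto
  have K: "harnack_kernel n z T = B + B' - 1\<^sub>m n"
    by (simp add: harnack_kernel_def inv inv')
  show "harnack_kernel n z T \<in> carrier_mat n n"
    using B B' by (auto simp: K)
  assume u: "u \<in> carrier_vec n" and v_def: "v = u - cnj z \<cdot>\<^sub>v (T *\<^sub>v u)"
  have v: "v \<in> carrier_vec n" and Au: "?A *\<^sub>v u = v"
    using u Tc by (auto simp: v_def minus_smult_mult_vec)
  have Bv: "B *\<^sub>v v = u"
    using u BA assoc_mult_mat_vec[OF B A u] by (simp add: Au)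
  have "?A' *\<^sub>v (B' *\<^sub>v v) = v"
    using v AB' assoc_mult_mat_vec[OF A' B' v] by simp
  \<comment> \<open>Write the second \<open>v\<close> as \<open>?A *\<^sub>v u\<close> and move
    \<open>?A\<close> across the inner product, where its adjoint cancels \<open>B'\<close>.\<close>
  then have B'v: "(B' *\<^sub>v v) \<bullet>c v = v \<bullet>c u"
    using mat_adjoint_cscalar_prod[OF A _ u, of "B' *\<^sub>v v"] B' v by (simp add: adj Au)
  have dist: "(B + B' - 1\<^sub>m n) *\<^sub>v v = B *\<^sub>v v + B' *\<^sub>v v - v"
    using B B' v by (simp add: minus_mult_distrib_mat_vec[of _ n n] add_mult_distrib_mat_vec[of _ n n])
  have sub: "u - v = cnj z \<cdot>\<^sub>v (T *\<^sub>v u)"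
    using u Tc by (auto simp: v_def)
  have "(harnack_kernel n z T *\<^sub>v v) \<bullet>c v = (B *\<^sub>v v) \<bullet>c v + (B' *\<^sub>v v) \<bullet>c v - v \<bullet>c v"
    unfolding K dist using B B' v
    by (simp add: minus_scalar_prod_distrib[of _ n] add_scalar_prod_distrib[of _ n])
  also have "\<dots> = u \<bullet>c u - (u - v) \<bullet>c (u - v)"
    using polarization[OF u v] by (simp add: Bv B'v)
  also have "\<dots> = complex_of_real (energy z T u)"
    by (simp add: sub cscalar_prod_self cvec_norm_smult energy_def power_mult_distrib)
  finally show "(harnack_kernel n z T *\<^sub>v v) \<bullet>c v = complex_of_real (energy z T u)" .
qed

text \<open>Every \<open>v\<close> is both \<open>(I - cnj z T1) u\<close> and
  \<open>(I - cnj z T0) w\<close>, since these operators are invertible. Testing the Loewner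
  inequality at \<open>v\<close> therefore compares the energies of the coupled vectors
  \<open>u\<close> and \<open>w\<close>.\<close>

lemma harnack_dominated_iff_energy:
  assumes T1: "T1 \<in> contractions n" and T0: "T0 \<in> contractions n"
  shows "harnack_dominated n T1 T0 \<longleftrightarrow>
    (\<exists>c::real. c \<ge> 1 \<and> (\<forall>z u w. cmod z < 1 \<longrightarrow> u \<in> carrier_vec n \<longrightarrow> w \<in> carrier_vec n \<longrightarrow>
      u - cnj z \<cdot>\<^sub>v (T1 *\<^sub>v u) = w - cnj z \<cdot>\<^sub>v (T0 *\<^sub>v w) \<longrightarrow>
      energy z T1 u \<le> c\<^sup>2 * energy z T0 w))"
proof -
  have key: "((complex_of_real (c\<^sup>2) \<cdot>\<^sub>m harnack_kernel n z T0 - harnack_kernel n z T1) *\<^sub>v v) \<bullet>c v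
      = complex_of_real (c\<^sup>2 * energy z T0 w - energy z T1 u)"
    if z: "cmod z < 1" and u: "u \<in> carrier_vec n" and w: "w \<in> carrier_vec n"
      and vu: "v = u - cnj z \<cdot>\<^sub>v (T1 *\<^sub>v u)" and vw: "v = w - cnj z \<cdot>\<^sub>v (T0 *\<^sub>v w)" for c z u w v
  proof -
    have v: "v \<in> carrier_vec n" using T0 w by (auto simp: vw contractions_def)
    note K1 = harnack_kernel_energy[OF T1 z] and K0 = harnack_kernel_energy[OF T0 z]
    have "((complex_of_real (c\<^sup>2) \<cdot>\<^sub>m harnack_kernel n z T0 - harnack_kernel n z T1) *\<^sub>v v)
        = complex_of_real (c\<^sup>2) \<cdot>\<^sub>v (harnack_kernel n z T0 *\<^sub>v v) - harnack_kernel n z T1 *\<^sub>v v"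
      using K1(1) K0(1) v by (auto simp: minus_mult_distrib_mat_vec[of _ n n])
    also have "\<dots> \<bullet>c v = complex_of_real (c\<^sup>2) * ((harnack_kernel n z T0 *\<^sub>v v) \<bullet>c v)
        - (harnack_kernel n z T1 *\<^sub>v v) \<bullet>c v"
      using K1(1) K0(1) v by (simp add: minus_scalar_prod_distrib[of _ n])
    finally show ?thesis using K1(2)[OF u vu] K0(2)[OF w vw] by simp
  qed
  have solve: "\<exists>u \<in> carrier_vec n. v = u - cnj z \<cdot>\<^sub>v (T *\<^sub>v u)"
    if T: "T \<in> contractions n" and z: "cmod z < 1" and v: "v \<in> carrier_vec n" for T z v
  proof -
    have Tc: "T \<in> carrier_mat n n" using T by (simp add: contractions_def)
    obtain B where B: "B \<in> carrier_mat n n" and AB: "(1\<^sub>m n - cnj z \<cdot>\<^sub>m T) * B = 1\<^sub>m n"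
      using contraction_resolvent[OF T z] by metis
    have A: "1\<^sub>m n - cnj z \<cdot>\<^sub>m T \<in> carrier_mat n n" using Tc by auto
    show ?thesis
      using minus_smult_mult_vec[OF Tc, of "B *\<^sub>v v" "cnj z"] assoc_mult_mat_vec[OF A B v] AB B v
      by (intro bexI[of _ "B *\<^sub>v v"]) auto
  qed
  have "loewner_le n (harnack_kernel n z T1) (complex_of_real (c\<^sup>2) \<cdot>\<^sub>m harnack_kernel n z T0) \<longleftrightarrow>
      (\<forall>u w. u \<in> carrier_vec n \<longrightarrow> w \<in> carrier_vec n \<longrightarrow>
      u - cnj z \<cdot>\<^sub>v (T1 *\<^sub>v u) = w - cnj z \<cdot>\<^sub>v (T0 *\<^sub>v w) \<longrightarrow>
      energy z T1 u \<le> c\<^sup>2 * energy z T0 w)" (is "?L \<longleftrightarrow> ?R") if z: "cmod z < 1" for c z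
  proof
    assume L: ?L
    show ?R
    proof (intro allI impI)
      fix u w assume u: "u \<in> carrier_vec n" and w: "w \<in> carrier_vec n"
        and eq: "u - cnj z \<cdot>\<^sub>v (T1 *\<^sub>v u) = w - cnj z \<cdot>\<^sub>v (T0 *\<^sub>v w)"
      have "w - cnj z \<cdot>\<^sub>v (T0 *\<^sub>v w) \<in> carrier_vec n"
        using T0 w by (auto simp: contractions_def)
      then have "0 \<le> complex_of_real (c\<^sup>2 * energy z T0 w - energy z T1 u)"
        using L key[OF z u w eq[symmetric] refl, of c] by (auto simp: loewner_le_def)
      then show "energy z T1 u \<le> c\<^sup>2 * energy z T0 w"
        by (simp add: less_eq_complex_def)
    qed
  next
    assume R: ?R
    show ?L
      unfolding loewner_le_def
    proof (intro conjI ballI)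
      fix v :: "complex vec" assume v: "v \<in> carrier_vec n"
      obtain u where u: "u \<in> carrier_vec n" "v = u - cnj z \<cdot>\<^sub>v (T1 *\<^sub>v u)"
        using solve[OF T1 z v] by blast
      obtain w where w: "w \<in> carrier_vec n" "v = w - cnj z \<cdot>\<^sub>v (T0 *\<^sub>v w)"
        using solve[OF T0 z v] by blast
      have "energy z T1 u \<le> c\<^sup>2 * energy z T0 w" using R u w by auto
      then show "0 \<le> ((complex_of_real (c\<^sup>2) \<cdot>\<^sub>m harnack_kernel n z T0 - harnack_kernel n z T1) *\<^sub>v v) \<bullet>c v"
        by (simp only: key[OF z u(1) w(1) u(2) w(2)]) (simp add: less_eq_complex_def)
    qed (use harnack_kernel_energy(1)[OF T1 z] harnack_kernel_energy(1)[OF T0 z] in auto)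
  qed
  then show ?thesis
    unfolding harnack_dominated_def by blast
qed

section \<open>Jordan blocks with a corner entry\<close>

lemma corner_jordan_block_carrier [simp]: "corner_jordan_block n a \<in> carrier_mat n n"
  by (simp add: corner_jordan_block_def)

lemma corner_jordan_block_0: "corner_jordan_block n 0 = jordan_block n 0"
  by (rule eq_matI) (auto simp: corner_jordan_block_def)

lemma corner_jordan_block_mult_vec:
  assumes u: "u \<in> carrier_vec n" and i: "i < n"
  shows "(corner_jordan_block n a *\<^sub>v u) $ i = (if i = n - 1 then a * u $ 0 else u $ Suc i)"
proof -
  have "(corner_jordan_block n a *\<^sub>v u) $ i
      = (\<Sum>j<n. corner_jordan_block n a $$ (i, j) * u $ j)"
    using u i by (simp add: corner_jordan_block_def scalar_prod_def atLeast0LessThan)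
  also have "\<dots> = (\<Sum>j<n. if j = (if i = n - 1 then 0 else Suc i)
      then (if i = n - 1 then a else 1) * u $ j else 0)"
    using i by (intro sum.cong) (auto simp: corner_jordan_block_def)
  also have "\<dots> = (if i = n - 1 then a * u $ 0 else u $ Suc i)"
    using i by (subst sum.delta) auto
  finally show ?thesis .
qed

text \<open>The block shifts the later coordinates and moves \<open>u $ 0\<close>, scaled by
  \<open>a\<close>, to the last place. For \<open>cmod z < 1\<close> the weight of
  \<open>u $ 0\<close> is at least \<open>1 - (cmod a)\<^sup>2\<close>, while the common weight of
  the others tends to 0 as \<open>cmod z\<close> tends to 1.\<close>

lemma energy_corner_jordan_block:
  assumes n: "n \<ge> 1" and u: "u \<in> carrier_vec n"
  shows "energy z (corner_jordan_block n a) u = (1 - (cmod z)\<^sup>2 * (cmod a)\<^sup>2) * (cmod (u $ 0))\<^sup>2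
    + (1 - (cmod z)\<^sup>2) * (\<Sum>i<n - 1. (cmod (u $ Suc i))\<^sup>2)"
proof -
  obtain m where m: "n = Suc m" using n by (cases n) auto
  have "(cvec_norm (corner_jordan_block n a *\<^sub>v u))\<^sup>2
      = (\<Sum>i<n. (cmod ((corner_jordan_block n a *\<^sub>v u) $ i))\<^sup>2)"
    by (rule cvec_norm_sq[OF mult_mat_vec_carrier[OF corner_jordan_block_carrier u]])
  also have "\<dots> = (\<Sum>i<n. (cmod (if i = n - 1 then a * u $ 0 else u $ Suc i))\<^sup>2)"
    by (intro sum.cong refl) (simp add: corner_jordan_block_mult_vec[OF u])
  also have "\<dots> = (\<Sum>i<m. (cmod (u $ Suc i))\<^sup>2) + (cmod a)\<^sup>2 * (cmod (u $ 0))\<^sup>2"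
    by (simp add: m norm_mult power_mult_distrib)
  finally have 1: "(cvec_norm (corner_jordan_block n a *\<^sub>v u))\<^sup>2
      = (\<Sum>i<m. (cmod (u $ Suc i))\<^sup>2) + (cmod a)\<^sup>2 * (cmod (u $ 0))\<^sup>2" .
  have 2: "(cvec_norm u)\<^sup>2 = (cmod (u $ 0))\<^sup>2 + (\<Sum>i<m. (cmod (u $ Suc i))\<^sup>2)"
    unfolding cvec_norm_sq[OF u] m by (rule sum.lessThan_Suc_shift)
  show ?thesis
    unfolding energy_def 1 2 by (simp add: m algebra_simps)
qed

lemma corner_jordan_block_contraction:
  assumes n: "n \<ge> 1" and a: "cmod a \<le> 1"
  shows "corner_jordan_block n a \<in> contractions n"
proof -
  have "cvec_norm (corner_jordan_block n a *\<^sub>v u) \<le> cvec_norm u" if u: "u \<in> carrier_vec n" for u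
  proof (rule power2_le_imp_le)
    have "(cmod a)\<^sup>2 \<le> 1" using a by (simp add: power_le_one)
    then have "0 \<le> energy 1 (corner_jordan_block n a) u"
      by (simp add: energy_corner_jordan_block[OF n u])
    then show "(cvec_norm (corner_jordan_block n a *\<^sub>v u))\<^sup>2 \<le> (cvec_norm u)\<^sup>2"
      by (simp add: energy_def)
  qed simp
  then show ?thesis
    by (simp add: contractions_def op_norm_le_1_iff[of _ n n])
qed

text \<open>The two matrices differ at most in the corner, so \<open>d = u - w\<close> satisfies
  \<open>d_i = \<zeta> d_(i+1)\<close> above the last row, and the last row supplies the starting
  value of this backward recursion.\<close>

lemma corner_jordan_block_resolvent_diff:
  assumes u: "u \<in> carrier_vec n" and w: "w \<in> carrier_vec n"
    and eq: "u - \<zeta> \<cdot>\<^sub>v (corner_jordan_block n a *\<^sub>v u) = w - \<zeta> \<cdot>\<^sub>v (corner_jordan_block n b *\<^sub>v w)"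
    and k: "k < n"
  shows "u $ k - w $ k = \<zeta> ^ (n - k) * (a * u $ 0 - b * w $ 0)"
proof -
  have comp: "u $ i - \<zeta> * (corner_jordan_block n a *\<^sub>v u) $ i
      = w $ i - \<zeta> * (corner_jordan_block n b *\<^sub>v w) $ i" if "i < n" for i
    using arg_cong[OF eq, of "\<lambda>x. x $ i"] u w that
    by (simp add: corner_jordan_block_def)
  have step: "u $ i - w $ i = \<zeta> * (u $ Suc i - w $ Suc i)" if "Suc i < n" for i
    using comp[of i] that
    by (auto simp: corner_jordan_block_mult_vec[OF u] corner_jordan_block_mult_vec[OF w] algebra_simps
        split: if_splits)
  have last: "u $ (n - 1) - w $ (n - 1) = \<zeta> * (a * u $ 0 - b * w $ 0)"
    using comp[of "n - 1"] k
    by (simp add: corner_jordan_block_mult_vec[OF u] corner_jordan_block_mult_vec[OF w] algebra_simps)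
  \<comment> \<open>Here \<open>j\<close> is the distance from the last index.\<close>
  have "u $ (n - Suc j) - w $ (n - Suc j) = \<zeta> ^ Suc j * (a * u $ 0 - b * w $ 0)" if "j < n" for j
    using that
  proof (induction j)
    case 0
    then show ?case using last by simp
  next
    case (Suc j)
    then have "Suc (n - Suc (Suc j)) = n - Suc j" by simp
    then show ?case using step[of "n - Suc (Suc j)"] Suc by simp
  qed
  from this[of "n - Suc k"] k show ?thesis by (simp add: Suc_diff_Suc)
qed

lemma norm_add_sq_le: "(norm (x + y))\<^sup>2 \<le> 2 * (norm x)\<^sup>2 + 2 * (norm (y :: 'a :: real_normed_vector))\<^sup>2"
proof -
  have "(norm (x + y))\<^sup>2 \<le> (norm x + norm y)\<^sup>2"
    by (intro power_mono norm_triangle_ineq) simp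
  moreover have "0 \<le> (norm x - norm y)\<^sup>2" by simp
  ultimately show ?thesis by (simp add: power2_eq_square algebra_simps)
qed

text \<open>With \<open>\<zeta> = cnj z\<close>, coordinate 0 of the difference formula reads
  \<open>u_0 (1 - \<zeta>^n a) = w_0 (1 - \<zeta>^n b)\<close>. Hence a multiple of
  \<open>|w_0|\<close> bounds \<open>u_0\<close> and then every coordinate of \<open>u - w\<close>.
  The weight of \<open>w_0\<close> in its energy is bounded below uniformly in \<open>z\<close> and
  absorbs the error.\<close>

lemma harnack_dominated_corner_jordan_block:
  assumes n: "n \<ge> 1" and a: "cmod a < 1" and b: "cmod b < 1"
  shows "harnack_dominated n (corner_jordan_block n a) (corner_jordan_block n b)"
proof -
  \<comment> \<open>\<open>D\<close> bounds \<open>|u_0|\<close> in terms of \<open>|w_0|\<close>,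
    from \<open>|1 - \<zeta>^n b| \<le> 2\<close> and
    \<open>|1 - \<zeta>^n a| \<ge> 1 - |a|\<close>. \<open>E\<close> collects the multiples of
    \<open>|w_0|^2\<close>: \<open>D\<^sup>2\<close> from \<open>u_0\<close>, the rest from the
    other coordinates. \<open>K\<close> is at least 2, for the tail of \<open>w\<close>, and
    \<open>K (1 - |b|^2)\<close> is at least \<open>E\<close>.\<close>
  define D where "D = 2 / (1 - cmod a)"
  define E where "E = D\<^sup>2 + 2 * real n * (D + 1)\<^sup>2"
  define K where "K = 2 + E / (1 - (cmod b)\<^sup>2)"
  have D: "D \<ge> 0" using a by (simp add: D_def)
  have E: "E \<ge> 0" by (simp add: E_def)
  have b2: "0 < 1 - (cmod b)\<^sup>2" using b by (simp add: power_less_one_iff abs_square_less_1)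
  have K: "K \<ge> 2" using E b2 by (simp add: K_def)
  have "energy z (corner_jordan_block n a) u \<le> K * energy z (corner_jordan_block n b) w"
    if z: "cmod z < 1" and u: "u \<in> carrier_vec n" and w: "w \<in> carrier_vec n"
      and eq: "u - cnj z \<cdot>\<^sub>v (corner_jordan_block n a *\<^sub>v u) = w - cnj z \<cdot>\<^sub>v (corner_jordan_block n b *\<^sub>v w)"
    for z u w
  proof -
    let ?x = "cmod (u $ 0)" and ?y = "cmod (w $ 0)"
    let ?U = "\<Sum>i<n - 1. (cmod (u $ Suc i))\<^sup>2" and ?W = "\<Sum>i<n - 1. (cmod (w $ Suc i))\<^sup>2"
    note diff = corner_jordan_block_resolvent_diff[OF u w eq]
    have pow: "cmod (cnj z ^ k) \<le> 1" for k using z by (simp add: norm_power power_le_one)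
    have "u $ 0 * (1 - cnj z ^ n * a) = w $ 0 * (1 - cnj z ^ n * b)"
      using diff[of 0] n by (simp add: algebra_simps)
    then have eq0: "?x * cmod (1 - cnj z ^ n * a) = ?y * cmod (1 - cnj z ^ n * b)"
      by (metis norm_mult)
    have "cmod (cnj z ^ n * a) \<le> cmod a"
      using mult_right_mono[OF pow[of n] norm_ge_zero[of a]] by (simp add: norm_mult)
    then have lo: "1 - cmod a \<le> cmod (1 - cnj z ^ n * a)"
      using norm_triangle_ineq2[of 1 "cnj z ^ n * a"] by simp
    have "cmod (cnj z ^ n * b) \<le> 1"
      using mult_mono[OF pow[of n] less_imp_le[OF b]] by (simp add: norm_mult)
    then have hi: "cmod (1 - cnj z ^ n * b) \<le> 2"
      using norm_triangle_ineq4[of 1 "cnj z ^ n * b"] by simp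
    have "?x * (1 - cmod a) \<le> ?y * 2"
      using mult_left_mono[OF lo, of ?x] mult_left_mono[OF hi, of ?y] eq0 by simp
    then have x: "?x \<le> D * ?y" using a by (simp add: D_def field_simps)
    have comp: "(cmod (u $ k))\<^sup>2 \<le> 2 * (cmod (w $ k))\<^sup>2 + 2 * ((D + 1)\<^sup>2 * ?y\<^sup>2)" if "k < n" for k
    proof -
      have "cmod (u $ k - w $ k) \<le> cmod (a * u $ 0 - b * w $ 0)"
        using mult_right_mono[OF pow[of "n - k"], of "cmod (a * u $ 0 - b * w $ 0)"] diff[OF that]
        by (simp add: norm_mult)
      also have "\<dots> \<le> cmod a * ?x + cmod b * ?y"
        by (metis norm_mult norm_triangle_ineq4)
      also have "\<dots> \<le> 1 * ?x + 1 * ?y"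
        using a b by (intro add_mono mult_right_mono) auto
      also have "\<dots> \<le> (D + 1) * ?y" using x by (simp add: algebra_simps)
      finally have "(cmod (u $ k - w $ k))\<^sup>2 \<le> ((D + 1) * ?y)\<^sup>2" by (intro power_mono) auto
      then show ?thesis
        using norm_add_sq_le[of "w $ k" "u $ k - w $ k"] by (simp add: power_mult_distrib)
    qed
    have "?U \<le> (\<Sum>i<n - 1. 2 * (cmod (w $ Suc i))\<^sup>2 + 2 * ((D + 1)\<^sup>2 * ?y\<^sup>2))"
      by (intro sum_mono comp) auto
    also have "\<dots> = 2 * ?W + real (n - 1) * (2 * ((D + 1)\<^sup>2 * ?y\<^sup>2))"
      by (simp add: sum.distrib sum_distrib_left)
    also have "\<dots> \<le> 2 * ?W + real n * (2 * ((D + 1)\<^sup>2 * ?y\<^sup>2))"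
      by (intro add_left_mono mult_right_mono) auto
    finally have U: "?U \<le> 2 * ?W + 2 * real n * (D + 1)\<^sup>2 * ?y\<^sup>2" by (simp add: mult_ac)
    have x2: "?x\<^sup>2 \<le> D\<^sup>2 * ?y\<^sup>2"
      using power_mono[OF x, of 2] by (simp add: power_mult_distrib)
    define t where "t = (cmod z)\<^sup>2"
    have t: "0 \<le> t" "t < 1"
      using z by (auto simp: t_def abs_square_less_1)
    have "energy z (corner_jordan_block n a) u \<le> 1 * ?x\<^sup>2 + (1 - t) * ?U"
      unfolding energy_corner_jordan_block[OF n u] t_def[symmetric]
      by (intro add_mono mult_right_mono) (use t in \<open>auto intro: sum_nonneg\<close>)
    also have "\<dots> \<le> D\<^sup>2 * ?y\<^sup>2 + (1 - t) * (2 * ?W + 2 * real n * (D + 1)\<^sup>2 * ?y\<^sup>2)"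
      using x2 U t by (intro add_mono mult_left_mono) auto
    \<comment> \<open>The factor \<open>1 - t\<close> is given up only in the term with
      \<open>?y\<close>; the tail \<open>?W\<close> has to keep it, since it carries this weight in
      the energy of \<open>w\<close>.\<close>
    also have "\<dots> \<le> D\<^sup>2 * ?y\<^sup>2 + ((1 - t) * (2 * ?W) + 1 * (2 * real n * (D + 1)\<^sup>2 * ?y\<^sup>2))"
      unfolding distrib_left using t by (intro add_left_mono mult_right_mono) auto
    also have "\<dots> = E * ?y\<^sup>2 + 2 * ((1 - t) * ?W)"
      by (simp add: E_def algebra_simps)
    also have "\<dots> \<le> K * ((1 - (cmod b)\<^sup>2) * ?y\<^sup>2) + K * ((1 - t) * ?W)"
    proof (rule add_mono)
      have "K * (1 - (cmod b)\<^sup>2) = 2 * (1 - (cmod b)\<^sup>2) + E"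
        using b2 by (simp add: K_def distrib_right)
      then have "E \<le> K * (1 - (cmod b)\<^sup>2)" using b2 by simp
      then show "E * ?y\<^sup>2 \<le> K * ((1 - (cmod b)\<^sup>2) * ?y\<^sup>2)"
        unfolding mult.assoc[symmetric] by (intro mult_right_mono) auto
      show "2 * ((1 - t) * ?W) \<le> K * ((1 - t) * ?W)"
        using K t by (intro mult_right_mono mult_nonneg_nonneg sum_nonneg) auto
    qed
    also have "\<dots> \<le> K * ((1 - t * (cmod b)\<^sup>2) * ?y\<^sup>2) + K * ((1 - t) * ?W)"
      using K t by (intro add_right_mono mult_left_mono mult_right_mono) (auto simp: mult_left_le_one_le)
    also have "\<dots> = K * energy z (corner_jordan_block n b) w"
      unfolding energy_corner_jordan_block[OF n w] t_def by (simp add: distrib_left)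
    finally show ?thesis .
  qed
  \<comment> \<open>Domination is stated with \<open>c\<^sup>2\<close>, hence the square
    root.\<close>
  moreover have "1 \<le> sqrt K" "(sqrt K)\<^sup>2 = K" using K by auto
  ultimately show ?thesis
    unfolding harnack_dominated_iff_energy[OF
        corner_jordan_block_contraction[OF n less_imp_le[OF a]]
        corner_jordan_block_contraction[OF n less_imp_le[OF b]]]
    by (intro exI[of _ "sqrt K"]) auto
qed

section \<open>Passage to the unit circle\<close>

text \<open>Serves to let the radius tend to 1 in energy inequalities known inside the disc.\<close>

lemma le_at_1_if_le_below:
  fixes f g :: "real \<Rightarrow> real"
  assumes "isCont f 1" "isCont g 1" and le: "\<And>r. 0 \<le> r \<Longrightarrow> r < 1 \<Longrightarrow> f r \<le> g r"
  shows "f 1 \<le> g 1"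
proof (rule tendsto_le[OF trivial_limit_at_left_real])
  show "(f \<longlongrightarrow> f 1) (at_left 1)" "(g \<longlongrightarrow> g 1) (at_left 1)"
    using assms by (auto simp: isCont_def intro: filterlim_at_split[THEN iffD1, THEN conjunct1])
  show "eventually (\<lambda>r. f r \<le> g r) (at_left 1)"
    by (rule eventually_at_leftI[of 0]) (auto intro: le)
qed

text \<open>The \<open>i\<close>-th coordinate of \<open>(I - \<zeta> J)\<^sup>-\<^sup>1 (I - \<zeta> T) u\<close>.\<close>

definition resolvent_coord :: "nat \<Rightarrow> complex mat \<Rightarrow> complex \<Rightarrow> complex vec \<Rightarrow> nat \<Rightarrow> complex" where
  "resolvent_coord n T \<zeta> u i = (\<Sum>k\<in>{i..<n}. \<zeta> ^ (k - i) * (u $ k - \<zeta> * (T *\<^sub>v u) $ k))"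

text \<open>As \<open>J\<close> is nilpotent, the Neumann series of
  \<open>(I - \<zeta> J)^-1\<close> is a finite sum, valid for every \<open>\<zeta>\<close>, also on
  the unit circle. Splitting off its first term gives \<open>w_i = v_i + \<zeta> w_(i+1)\<close> for
  \<open>v = (I - \<zeta> T) u\<close>, which is the claimed equation.\<close>

lemma resolvent_coord_solves:
  assumes T: "T \<in> carrier_mat n n" and u: "u \<in> carrier_vec n"
  shows "u - \<zeta> \<cdot>\<^sub>v (T *\<^sub>v u) = vec n (resolvent_coord n T \<zeta> u)
    - \<zeta> \<cdot>\<^sub>v (corner_jordan_block n 0 *\<^sub>v vec n (resolvent_coord n T \<zeta> u))"
proof (rule eq_vecI)
  let ?w = "vec n (resolvent_coord n T \<zeta> u)"
  fix i assume "i < dim_vec (?w - \<zeta> \<cdot>\<^sub>v (corner_jordan_block n 0 *\<^sub>v ?w))"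
  then have i: "i < n" by (simp add: corner_jordan_block_def)
  have J: "(corner_jordan_block n 0 *\<^sub>v ?w) $ i = (if i = n - 1 then 0 else ?w $ Suc i)"
    using i by (simp add: corner_jordan_block_mult_vec[of _ n])
  have split: "{i..<n} = insert i {Suc i..<n}" using i by auto
  have "(\<Sum>k = Suc i..<n. \<zeta> ^ (k - i) * (u $ k - \<zeta> * (T *\<^sub>v u) $ k))
      = \<zeta> * (\<Sum>k = Suc i..<n. \<zeta> ^ (k - Suc i) * (u $ k - \<zeta> * (T *\<^sub>v u) $ k))"
    unfolding sum_distrib_left
    by (rule sum.cong) (auto simp: Suc_diff_le[symmetric] power_Suc[symmetric] mult.assoc[symmetric]
        simp del: power_Suc)
  then have "resolvent_coord n T \<zeta> u i
      = u $ i - \<zeta> * (T *\<^sub>v u) $ i + \<zeta> * (if i = n - 1 then 0 else ?w $ Suc i)"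
    using i by (auto simp: resolvent_coord_def split)
  then show "(u - \<zeta> \<cdot>\<^sub>v (T *\<^sub>v u)) $ i = (?w - \<zeta> \<cdot>\<^sub>v (corner_jordan_block n 0 *\<^sub>v ?w)) $ i"
    using i J T u by (simp add: corner_jordan_block_def del: index_mult_mat_vec)
qed (use T u in \<open>auto simp: corner_jordan_block_def\<close>)

lemma isCont_resolvent_coord [continuous_intros]:
  "isCont (\<lambda>r::real. resolvent_coord n T (complex_of_real r * \<omega>) u i) s"
  unfolding resolvent_coord_def by (intro continuous_intros)

text \<open>In the energy of \<open>w\<close> for \<open>J\<close> all coordinates but the first
  carry the factor \<open>1 - |z|^2\<close>. They are continuous up to the circle, so only
  coordinate 0 survives in the limit.\<close>

lemma energy_le_resolvent_coord:
  assumes n: "n \<ge> 1" and T: "T \<in> contractions n"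
    and dom: "harnack_dominated n T (jordan_block n 0)"
  obtains C where "\<And>u \<omega>. u \<in> carrier_vec n \<Longrightarrow> cmod \<omega> = 1 \<Longrightarrow>
    energy 1 T u \<le> C * (cmod (resolvent_coord n T \<omega> u 0))\<^sup>2"
proof -
  have Tc: "T \<in> carrier_mat n n" using T by (simp add: contractions_def)
  note J = corner_jordan_block_contraction[OF n, of 0, simplified]
  obtain c where c: "\<And>z u w. cmod z < 1 \<Longrightarrow> u \<in> carrier_vec n \<Longrightarrow> w \<in> carrier_vec n \<Longrightarrow>
      u - cnj z \<cdot>\<^sub>v (T *\<^sub>v u) = w - cnj z \<cdot>\<^sub>v (corner_jordan_block n 0 *\<^sub>v w) \<Longrightarrow>
      energy z T u \<le> c\<^sup>2 * energy z (corner_jordan_block n 0) w"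
    using dom unfolding corner_jordan_block_0[symmetric] harnack_dominated_iff_energy[OF T J] by blast
  have "energy 1 T u \<le> c\<^sup>2 * (cmod (resolvent_coord n T \<omega> u 0))\<^sup>2"
    if u: "u \<in> carrier_vec n" and \<omega>: "cmod \<omega> = 1" for u \<omega>
  proof -
    let ?R = "\<lambda>r. resolvent_coord n T (complex_of_real r * \<omega>) u"
    \<comment> \<open>The terms \<open>1\<^sup>2\<close> keep the goal in the literal form
      \<open>f 1 \<le> g 1\<close>.\<close>
    have "(cvec_norm u)\<^sup>2 - 1\<^sup>2 * (cvec_norm (T *\<^sub>v u))\<^sup>2 \<le>
      c\<^sup>2 * ((cmod (?R 1 0))\<^sup>2 + (1 - 1\<^sup>2) * (\<Sum>i<n - 1. (cmod (?R 1 (Suc i)))\<^sup>2))"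
    proof (rule le_at_1_if_le_below[where
          f = "\<lambda>r. (cvec_norm u)\<^sup>2 - r\<^sup>2 * (cvec_norm (T *\<^sub>v u))\<^sup>2" and
          g = "\<lambda>r. c\<^sup>2 * ((cmod (?R r 0))\<^sup>2 + (1 - r\<^sup>2) * (\<Sum>i<n - 1. (cmod (?R r (Suc i)))\<^sup>2))"])
      fix r :: real assume r: "0 \<le> r" "r < 1"
      \<comment> \<open>The conjugate makes \<open>cnj z\<close>, the parameter of the coupling
        equation, equal to \<open>r \<omega>\<close>.\<close>
      define z where "z = cnj (complex_of_real r * \<omega>)"
      have z: "cmod z = r" and cz: "cnj z = complex_of_real r * \<omega>"
        using r \<omega> by (simp_all add: z_def norm_mult)
      have "energy z T u \<le> c\<^sup>2 * energy z (corner_jordan_block n 0) (vec n (?R r))"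
        using resolvent_coord_solves[OF Tc u, of "cnj z"] r by (intro c u) (simp_all add: z cz)
      then show "(cvec_norm u)\<^sup>2 - r\<^sup>2 * (cvec_norm (T *\<^sub>v u))\<^sup>2 \<le>
          c\<^sup>2 * ((cmod (?R r 0))\<^sup>2 + (1 - r\<^sup>2) * (\<Sum>i<n - 1. (cmod (?R r (Suc i)))\<^sup>2))"
        using n by (simp add: energy_corner_jordan_block energy_def[of z T] z)
    qed (intro continuous_intros)+
    then show ?thesis by (simp add: energy_def)
  qed
  then show ?thesis using that by blast
qed

text \<open>The tail of the energy of \<open>w\<close> is nonnegative inside the disc and is dropped
  before the limit. The constant stays a square so that its sign is known when it multiplies a
  nonpositive energy.\<close>

lemma resolvent_coord_le_energy:
  assumes n: "n \<ge> 1" and T: "T \<in> contractions n"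
    and dom: "harnack_dominated n (jordan_block n 0) T"
  obtains C where "\<And>u \<omega>. u \<in> carrier_vec n \<Longrightarrow> cmod \<omega> = 1 \<Longrightarrow>
    (cmod (resolvent_coord n T \<omega> u 0))\<^sup>2 \<le> C\<^sup>2 * energy 1 T u"
proof -
  have Tc: "T \<in> carrier_mat n n" using T by (simp add: contractions_def)
  note J = corner_jordan_block_contraction[OF n, of 0, simplified]
  obtain c where c: "\<And>z u w. cmod z < 1 \<Longrightarrow> w \<in> carrier_vec n \<Longrightarrow> u \<in> carrier_vec n \<Longrightarrow>
      w - cnj z \<cdot>\<^sub>v (corner_jordan_block n 0 *\<^sub>v w) = u - cnj z \<cdot>\<^sub>v (T *\<^sub>v u) \<Longrightarrow>
      energy z (corner_jordan_block n 0) w \<le> c\<^sup>2 * energy z T u"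
    using dom unfolding corner_jordan_block_0[symmetric] harnack_dominated_iff_energy[OF J T] by blast
  have "(cmod (resolvent_coord n T \<omega> u 0))\<^sup>2 \<le> c\<^sup>2 * energy 1 T u"
    if u: "u \<in> carrier_vec n" and \<omega>: "cmod \<omega> = 1" for u \<omega>
  proof -
    let ?R = "\<lambda>r. resolvent_coord n T (complex_of_real r * \<omega>) u"
    have "(cmod (?R 1 0))\<^sup>2 \<le> c\<^sup>2 * ((cvec_norm u)\<^sup>2 - 1\<^sup>2 * (cvec_norm (T *\<^sub>v u))\<^sup>2)"
    proof (rule le_at_1_if_le_below[where f = "\<lambda>r. (cmod (?R r 0))\<^sup>2" and
          g = "\<lambda>r. c\<^sup>2 * ((cvec_norm u)\<^sup>2 - r\<^sup>2 * (cvec_norm (T *\<^sub>v u))\<^sup>2)"])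
      fix r :: real assume r: "0 \<le> r" "r < 1"
      define z where "z = cnj (complex_of_real r * \<omega>)"
      have z: "cmod z = r" and cz: "cnj z = complex_of_real r * \<omega>"
        using r \<omega> by (simp_all add: z_def norm_mult)
      have "(cmod (?R r 0))\<^sup>2 \<le> energy z (corner_jordan_block n 0) (vec n (?R r))"
        using n r by (auto simp: energy_corner_jordan_block z power_le_one intro!: mult_nonneg_nonneg sum_nonneg)
      also have "\<dots> \<le> c\<^sup>2 * energy z T u"
        using resolvent_coord_solves[OF Tc u, of "cnj z"] r by (intro c u) (simp_all add: z cz)
      finally show "(cmod (?R r 0))\<^sup>2 \<le> c\<^sup>2 * ((cvec_norm u)\<^sup>2 - r\<^sup>2 * (cvec_norm (T *\<^sub>v u))\<^sup>2)"
        by (simp add: energy_def z)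
    qed (intro continuous_intros)+
    then show ?thesis by (simp add: energy_def)
  qed
  then show ?thesis using that by blast
qed

section \<open>The first resolvent coordinate as a polynomial\<close>

definition resolvent_poly :: "nat \<Rightarrow> complex mat \<Rightarrow> complex vec \<Rightarrow> complex poly" where
  "resolvent_poly n T u = (\<Sum>k<n. monom (u $ k) k - monom ((T *\<^sub>v u) $ k) (Suc k))"

lemma poly_resolvent_poly: "poly (resolvent_poly n T u) \<zeta> = resolvent_coord n T \<zeta> u 0"
  by (simp add: resolvent_poly_def resolvent_coord_def poly_sum poly_monom atLeast0LessThan algebra_simps)

lemma coeff_resolvent_poly_0: "n \<ge> 1 \<Longrightarrow> coeff (resolvent_poly n T u) 0 = u $ 0"
  by (simp add: resolvent_poly_def coeff_sum)

text \<open>The case distinction concerns the top degree \<open>n\<close>, to which only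
  \<open>T *\<^sub>v u\<close> contributes.\<close>

lemma coeff_resolvent_poly_Suc:
  "i < n \<Longrightarrow> coeff (resolvent_poly n T u) (Suc i) = (if Suc i < n then u $ Suc i else 0) - (T *\<^sub>v u) $ i"
  by (simp add: resolvent_poly_def coeff_sum sum_subtractf)

text \<open>A finite connected set has at most one point, but the circle contains 1 and -1.\<close>

lemma infinite_unit_circle: "infinite {\<omega>::complex. cmod \<omega> = 1}"
proof -
  have eq: "{\<omega>::complex. cmod \<omega> = 1} = sphere 0 1" by (auto simp: sphere_def dist_norm)
  have "connected (sphere (0::complex) 1)" by (rule connected_sphere) simp
  moreover have "1 \<in> sphere (0::complex) 1" "-1 \<in> sphere (0::complex) 1" by auto
  ultimately show ?thesis
    unfolding eq by (metis connected_finite_iff_sing empty_iff one_neq_neg_one singletonD)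
qed

section \<open>Matrices equivalent to the Jordan block\<close>

lemma harnack_equivalent_imp_corner_jordan_block:
  assumes n: "n \<ge> 1" and T: "T \<in> contractions n"
    and equiv: "harnack_equivalent n T (jordan_block n 0)"
  shows "\<exists>a. cmod a < 1 \<and> T = corner_jordan_block n a"
proof -
  have Tc: "T \<in> carrier_mat n n" and
    contr: "\<And>u. u \<in> carrier_vec n \<Longrightarrow> cvec_norm (T *\<^sub>v u) \<le> cvec_norm u"
    using T op_norm_le_1_iff[of T n n] by (auto simp: contractions_def)
  obtain C where C: "\<And>u \<omega>. u \<in> carrier_vec n \<Longrightarrow> cmod \<omega> = 1 \<Longrightarrow>
      energy 1 T u \<le> C * (cmod (resolvent_coord n T \<omega> u 0))\<^sup>2"
    using energy_le_resolvent_coord[OF n T] equiv unfolding harnack_equivalent_def by blast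
  obtain C' where C': "\<And>u \<omega>. u \<in> carrier_vec n \<Longrightarrow> cmod \<omega> = 1 \<Longrightarrow>
      (cmod (resolvent_coord n T \<omega> u 0))\<^sup>2 \<le> C'\<^sup>2 * energy 1 T u"
    using resolvent_coord_le_energy[OF n T] equiv unfolding harnack_equivalent_def by blast
  \<comment> \<open>The energy does not involve \<open>\<omega>\<close>, so its nonpositivity makes
    the polynomial vanish on the whole circle, which is infinite.\<close>
  have poly_eq_0: "resolvent_poly n T u = 0" if u: "u \<in> carrier_vec n" and E: "energy 1 T u \<le> 0" for u
  proof -
    have "poly (resolvent_poly n T u) \<omega> = 0" if "cmod \<omega> = 1" for \<omega>
    proof -
      have "(cmod (resolvent_coord n T \<omega> u 0))\<^sup>2 \<le> 0"
        using C'[OF u that] mult_nonneg_nonpos[OF zero_le_power2 E] by (rule order_trans)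
      then show ?thesis by (simp add: poly_resolvent_poly)
    qed
    then have "{\<omega>. cmod \<omega> = 1} \<subseteq> {\<omega>. poly (resolvent_poly n T u) \<omega> = 0}" by blast
    then show ?thesis
      using infinite_unit_circle finite_subset poly_roots_finite by blast
  qed
  let ?e = "unit_vec n :: nat \<Rightarrow> complex vec"
  have Te: "(T *\<^sub>v ?e j) $ i = T $$ (i, j)" if "i < n" "j < n" for i j
    using Tc that by (simp add: scalar_prod_right_unit)
  \<comment> \<open>Otherwise the polynomial of \<open>?e 0\<close> would vanish, although its
    constant coefficient is 1.\<close>
  have e0: "energy 1 T (?e 0) > 0"
  proof (rule ccontr)
    assume "\<not> energy 1 T (?e 0) > 0"
    then have "resolvent_poly n T (?e 0) = 0" by (intro poly_eq_0) auto
    then show False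
      using coeff_resolvent_poly_0[OF n, of T "?e 0"] n by simp
  qed
  then have e0_coord: "resolvent_coord n T 1 (?e 0) 0 \<noteq> 0"
    using C[of "?e 0" 1] by auto
  have col: "T $$ (i, j) = (if Suc i = j then 1 else 0)" if i: "i < n" and j: "0 < j" "j < n" for i j
  proof -
    \<comment> \<open>Chosen so that the coordinate of \<open>?u\<close> vanishes at
      \<open>\<omega> = 1\<close>. By \<open>C\<close> this single zero already makes the energy
      nonpositive, and \<open>poly_eq_0\<close> spreads it to all \<open>\<omega>\<close>.\<close>
    define s where "s = resolvent_coord n T 1 (?e j) 0 / resolvent_coord n T 1 (?e 0) 0"
    let ?u = "?e j - s \<cdot>\<^sub>v ?e 0"
    have Tu: "T *\<^sub>v ?u = T *\<^sub>v ?e j - s \<cdot>\<^sub>v (T *\<^sub>v ?e 0)"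
      using Tc by (simp add: mult_minus_distrib_mat_vec[of _ n n] mult_mat_vec[of _ n n])
    have "resolvent_coord n T 1 ?u 0 = (\<Sum>k<n. (?e j $ k - (T *\<^sub>v ?e j) $ k)
        - s * (?e 0 $ k - (T *\<^sub>v ?e 0) $ k))"
      unfolding resolvent_coord_def Tu atLeast0LessThan
      using Tc by (intro sum.cong) (auto simp: algebra_simps simp del: index_mult_mat_vec)
    also have "\<dots> = resolvent_coord n T 1 (?e j) 0 - s * resolvent_coord n T 1 (?e 0) 0"
      by (simp only: resolvent_coord_def atLeast0LessThan sum_subtractf sum_distrib_left
          right_diff_distrib power_one mult_1)
    also have "\<dots> = 0" using e0_coord by (simp add: s_def)
    finally have "energy 1 T ?u \<le> 0" using C[of ?u 1] by simp
    then have q: "resolvent_poly n T ?u = 0" by (intro poly_eq_0) auto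
    \<comment> \<open>Since \<open>j > 0\<close>, the constant coefficient of the zero polynomial is
      \<open>- s\<close>.\<close>
    have "s = 0"
      using coeff_resolvent_poly_0[OF n, of T ?u] q n j by simp
    then have "?u = ?e j" by auto
    \<comment> \<open>Coefficient \<open>Suc i\<close> equates \<open>T $$ (i, j)\<close> with entry
      \<open>Suc i\<close> of \<open>?e j\<close>, read as 0 in the last row.\<close>
    with q coeff_resolvent_poly_Suc[OF i, of T "?e j"] show ?thesis
      using Te[OF i j(2)] j i by (auto split: if_splits)
  qed
  \<comment> \<open>By \<open>col\<close>, row \<open>i\<close> already contains a 1 in column
    \<open>Suc i\<close>; a second nonzero entry would give the row norm greater than 1.\<close>
  have col0: "T $$ (i, 0) = 0" if i: "Suc i < n" for i
  proof (rule ccontr)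
    define t where "t = T $$ (i, 0)"
    \<comment> \<open>This \<open>x\<close> aligns the column \<open>Suc i\<close> with the entry \<open>t\<close>, so that \<open>e\<^sub>0 + x e\<^bsub>i+1\<^esub>\<close> grows under \<open>T\<close>.\<close>
    define x where "x = t / complex_of_real ((cmod t)\<^sup>2)"
    assume "T $$ (i, 0) \<noteq> 0"
    then have t: "cmod t > 0" by (simp add: t_def)
    define u where "u = vec n (\<lambda>k. if k = 0 then 1 else if k = Suc i then x else 0)"
    have u: "u \<in> carrier_vec n" by (simp add: u_def)
    have "(cvec_norm u)\<^sup>2 = (\<Sum>k<n. (if k = 0 then 1 else 0) + (if k = Suc i then (cmod x)\<^sup>2 else 0))"
      unfolding cvec_norm_sq[OF u] by (intro sum.cong) (auto simp: u_def)
    also have "\<dots> = 1 + (cmod x)\<^sup>2" using i by (simp add: sum.distrib)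
    finally have norm_u: "(cvec_norm u)\<^sup>2 = 1 + (cmod x)\<^sup>2" .
    have "(T *\<^sub>v u) $ i = (\<Sum>k<n. T $$ (i, k) * u $ k)"
      using Tc i u by (simp add: scalar_prod_def atLeast0LessThan)
    also have "\<dots> = (\<Sum>k<n. (if k = 0 then t else 0) + (if k = Suc i then x else 0))"
      using i by (intro sum.cong) (auto simp: u_def t_def col)
    also have "\<dots> = t + x" using i by (simp add: sum.distrib)
    finally have Tui: "(T *\<^sub>v u) $ i = t + x" .
    have "(cmod (t + x))\<^sup>2 \<le> (\<Sum>k<n. (cmod ((T *\<^sub>v u) $ k))\<^sup>2)"
      unfolding Tui[symmetric] using i by (intro member_le_sum) auto
    also have "\<dots> = (cvec_norm (T *\<^sub>v u))\<^sup>2"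
      using cvec_norm_sq[OF mult_mat_vec_carrier[OF Tc u]] by simp
    also have "\<dots> \<le> 1 + (cmod x)\<^sup>2"
      using contr[OF u] by (simp add: norm_u[symmetric] power_mono)
    finally have le: "(cmod (t + x))\<^sup>2 \<le> 1 + (cmod x)\<^sup>2" .
    have "t + x = t * complex_of_real (1 + 1 / (cmod t)\<^sup>2)"
      using t by (simp add: x_def algebra_simps)
    then have 1: "cmod (t + x) = cmod t * (1 + 1 / (cmod t)\<^sup>2)"
      by (simp only: norm_mult norm_of_real) (simp add: add_nonneg_nonneg)
    have 2: "cmod x = 1 / cmod t"
      using t by (simp add: x_def norm_divide norm_mult power2_eq_square)
    \<comment> \<open>The terms \<open>1 / |t|^2\<close> on both sides of \<open>le\<close>
      cancel.\<close>
    have "(cmod t * (1 + 1 / (cmod t)\<^sup>2))\<^sup>2 = (cmod t)\<^sup>2 + 2 + (1 / cmod t)\<^sup>2"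
      using t by (simp add: field_simps power2_eq_square)
    then have "(cmod t)\<^sup>2 + 1 \<le> 0" using le unfolding 1 2 by simp
    then show False using zero_le_power2[of "cmod t"] by linarith
  qed
  define a where "a = T $$ (n - 1, 0)"
  have T_eq: "T = corner_jordan_block n a"
  proof (rule eq_matI)
    fix i j assume "i < dim_row (corner_jordan_block n a)" "j < dim_col (corner_jordan_block n a)"
    then have ij: "i < n" "j < n" by (simp_all add: corner_jordan_block_def)
    show "T $$ (i, j) = corner_jordan_block n a $$ (i, j)"
    proof (cases "j = 0")
      case True
      then show ?thesis
        using ij col0[of i] by (cases "i = n - 1") (auto simp: corner_jordan_block_def a_def)
    next
      case False
      then show ?thesis
        using ij col[of i j] by (auto simp: corner_jordan_block_def)
    qed
  qed (use Tc in \<open>auto simp: corner_jordan_block_def\<close>)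
  \<comment> \<open>The strict positivity in \<open>e0\<close> is what excludes a corner entry of
    modulus 1.\<close>
  have "energy 1 T (?e 0) = 1 - (cmod a)\<^sup>2"
    unfolding T_eq using n by (simp add: energy_corner_jordan_block)
  then have "cmod a < 1"
    using e0 abs_square_less_1[of "cmod a"] by simp
  with T_eq show ?thesis by blast
qed

theorem corollary2p22:
  fixes n :: nat
  assumes "n \<ge> 1"
  shows "harnack_part n (jordan_block n 0) = {corner_jordan_block n z | z. cmod z < 1}"
proof (intro subset_antisym subsetI)
  fix T assume "T \<in> harnack_part n (jordan_block n 0)"
  then show "T \<in> {corner_jordan_block n z | z. cmod z < 1}"
    using harnack_equivalent_imp_corner_jordan_block[OF assms] by (auto simp: harnack_part_def)
next
  fix T assume "T \<in> {corner_jordan_block n z | z. cmod z < 1}"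
  then obtain a where a: "cmod a < 1" and T: "T = corner_jordan_block n a" by blast
  \<comment> \<open>\<open>J\<close> is the block with corner 0, so both dominations are instances
    of one lemma.\<close>
  have "harnack_equivalent n T (corner_jordan_block n 0)"
    using assms a by (simp add: T harnack_equivalent_def harnack_dominated_corner_jordan_block)
  then show "T \<in> harnack_part n (jordan_block n 0)"
    using corner_jordan_block_contraction[OF assms less_imp_le[OF a]]
    by (simp add: harnack_part_def T corner_jordan_block_0)
qed

end
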